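(* Let $A\in\mathbb{R}^{m\times n}$, $b\in\mathbb{R}^m$, $\sigma\ge 0$, and let $\Phi:\mathbb{R}^n\to\mathbb{R}$ be defined by $\Phi(x):=\frac12(\|Ax-b\|_2-\sigma)_+^2$. Then $\Phi$ is differentiable with a Lipschitz continuous gradient. In particular, for $x\in\mathbb{R}^n$: (i) $\nabla\Phi(x)=\mathbf{0}_n$ if $\|Ax-b\|_2\le\sigma$, and $\nabla\Phi(x)=\left(1-\frac{\sigma}{\|Ax-b\|_2}\right)A^\top(Ax-b)$ otherwise; (ii) $\nabla\Phi$ is Lipschitz continuous (with respect to $\|\cdot\|_2$) with the Lipschitz constant $\|A\|_2^2$.
   Context: For $z\in\mathbb{R}$, $z_+:=z$ if $z>0$ and $z_+:=0$ otherwise, and $(\cdot)_+^2$ is the square of the positive part; $\|A\|_2$ is the largest singular value of $A$; $\mathbf{0}_n$ is the zero vector of $\mathbb{R}^n$. *)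

theory Defs
  imports "HOL-Analysis.Analysis"
begin

definition pos_part :: "real \<Rightarrow> real" where
  "pos_part z = (if z > 0 then z else 0)"

text \<open>Singular values as the nonnegative square roots of the eigenvalues of
  \<open>A\<^sup>T A\<close>. For a wide matrix (\<open>CARD('n) > CARD('m)\<close>) this adds the value \<open>0\<close> to the list
  of \<open>min m n\<close> singular values, which does not affect the largest one. The set is always finite
  and nonempty.\<close>

definition singular_values :: "real^'n^'m \<Rightarrow> real set" where
  "singular_values A =
    {s. 0 \<le> s \<and> (\<exists>v. v \<noteq> 0 \<and> (transpose A ** A) *v v = s\<^sup>2 *\<^sub>R v)}"

definition spectral_norm :: "real^'n^'m \<Rightarrow> real" where
  "spectral_norm A = Max (singular_values A)"

text \<open>Only meaningful where \<open>f\<close> is differentiable; there the vector is unique.\<close>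

definition gradient :: "('a::real_inner \<Rightarrow> real) \<Rightarrow> 'a \<Rightarrow> 'a" where
  "gradient f x = (THE g. GDERIV f x :> g)"

definition Phi :: "real^'n^'m \<Rightarrow> real^'m \<Rightarrow> real \<Rightarrow> real^'n \<Rightarrow> real" where
  "Phi A b \<sigma> x = 1 / 2 * (pos_part (norm (A *v x - b) - \<sigma>))\<^sup>2"

end

(*
  Phi is the function h y = (norm y - sigma)_+^2 / 2, half the squared distance to the ball of
  radius sigma, composed with x |-> A x - b. The residual T y = y - P y of the projection P onto
  that ball satisfies norm (T y) = (norm y - sigma)_+ and the variational inequality
  T y . (w - P y) <= 0 for all w in the ball. This yields at once
  0 <= h z - h y - T y . (z - y) <= norm (z - y)^2 / 2, so that T is the gradient of h, and the
  nonexpansiveness of T. The chain rule gives the gradient A^T T (A x - b) of Phi, and its Lipschitz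
  constant is the product of the operator norms of A^T and A, both bounded by the spectral norm:
  a unit vector maximising norm (A v) is an eigenvector of A^T A.
*)
theory Submission
  imports Defs
begin

section \<open>The residual of the projection onto a ball\<close>

text \<open>The case split is the one in the gradient formula, so that formula later follows by
  unfolding. For \<sigma> \<ge> 0 it also keeps \<open>y = 0\<close> away from the division.\<close>

definition ball_residual :: "real \<Rightarrow> 'a::real_inner \<Rightarrow> 'a" where
  "ball_residual \<sigma> y = (if norm y \<le> \<sigma> then 0 else (1 - \<sigma> / norm y) *\<^sub>R y)"

lemma norm_ball_residual:
  fixes y :: "'a::real_inner"
  assumes "0 \<le> \<sigma>"
  shows "norm (ball_residual \<sigma> y) = pos_part (norm y - \<sigma>)"
proof (cases "norm y \<le> \<sigma>")
  case False
  then have "0 < norm y" and abs: "\<bar>1 - \<sigma> / norm y\<bar> = 1 - \<sigma> / norm y"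
    using assms by (auto simp: abs_of_nonneg divide_le_eq_1)
  then show ?thesis
    using False by (simp add: ball_residual_def pos_part_def abs left_diff_distrib)
qed (simp add: ball_residual_def pos_part_def)

lemma minus_ball_residual:
  "y - ball_residual \<sigma> y = (if norm y \<le> \<sigma> then y else (\<sigma> / norm y) *\<^sub>R y)"
  by (simp add: ball_residual_def scaleR_left_diff_distrib)

lemma norm_minus_ball_residual_le:
  fixes y :: "'a::real_inner"
  assumes "0 \<le> \<sigma>"
  shows "norm (y - ball_residual \<sigma> y) \<le> \<sigma>"
  using assms by (auto simp: minus_ball_residual)

text \<open>Equality case of Cauchy-Schwarz: residual and projection are nonnegative multiples of
  \<open>y\<close>, and the projection has norm \<sigma> wherever the residual is nonzero.\<close>

lemma ball_residual_inner_projection: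
  fixes y :: "'a::real_inner"
  assumes "0 \<le> \<sigma>"
  shows "ball_residual \<sigma> y \<bullet> (y - ball_residual \<sigma> y) = \<sigma> * norm (ball_residual \<sigma> y)"
proof (cases "norm y \<le> \<sigma>")
  case False
  then have "norm y > 0" using assms by linarith
  then show ?thesis
    using False unfolding minus_ball_residual norm_ball_residual[OF assms]
    by (simp add: ball_residual_def pos_part_def dot_square_norm power2_eq_square field_simps)
qed (simp add: ball_residual_def)

text \<open>By Cauchy-Schwarz the inner product with the residual is at most \<sigma> times its norm
  on the ball, and the projection attains this value.\<close>

lemma ball_residual_variational:
  fixes y w :: "'a::real_inner"
  assumes "0 \<le> \<sigma>" "norm w \<le> \<sigma>"
  shows "ball_residual \<sigma> y \<bullet> (w - (y - ball_residual \<sigma> y)) \<le> 0"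
proof -
  have "ball_residual \<sigma> y \<bullet> w \<le> norm (ball_residual \<sigma> y) * norm w"
    by (rule norm_cauchy_schwarz)
  also have "\<dots> \<le> \<sigma> * norm (ball_residual \<sigma> y)"
    using assms by (simp add: mult.commute mult_right_mono)
  finally show ?thesis
    using ball_residual_inner_projection[OF assms(1), of y] by (simp only: inner_diff_right)
qed

lemma ball_residual_inner_projection_diff:
  fixes y z :: "'a::real_inner"
  assumes "0 \<le> \<sigma>"
  shows "ball_residual \<sigma> y \<bullet> (z - y) \<le> ball_residual \<sigma> y \<bullet> (ball_residual \<sigma> z - ball_residual \<sigma> y)"
  using ball_residual_variational[OF assms norm_minus_ball_residual_le[OF assms], of y z]
  by (simp add: inner_diff_right)

lemma norm_ball_residual_diff_le:
  fixes y z :: "'a::real_inner"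
  assumes "0 \<le> \<sigma>"
  shows "norm (ball_residual \<sigma> y - ball_residual \<sigma> z) \<le> norm (y - z)"
proof -
  define d where "d = ball_residual \<sigma> y - ball_residual \<sigma> z"
  \<comment> \<open>Sum of the variational inequalities at \<open>y\<close> and at \<open>z\<close>,
    each tested with the projection of the other point.\<close>
  have "d \<bullet> d \<le> d \<bullet> (y - z)"
    using ball_residual_inner_projection_diff[OF assms, of y z]
      ball_residual_inner_projection_diff[OF assms, of z y]
    by (simp add: d_def inner_diff_left inner_diff_right inner_commute)
  also have "\<dots> \<le> norm d * norm (y - z)"
    by (rule norm_cauchy_schwarz)
  finally have "norm d * norm d \<le> norm d * norm (y - z)"
    by (simp add: dot_square_norm power2_eq_square)
  then show ?thesis
    unfolding d_def[symmetric] by (cases "d = 0") auto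
qed

text \<open>The norm of the residual is the distance from \<open>z\<close> to the ball, so every
  point \<open>w\<close> of the ball bounds it.\<close>

lemma norm_ball_residual_le:
  fixes z w :: "'a::real_inner"
  assumes "0 \<le> \<sigma>" "norm w \<le> \<sigma>"
  shows "norm (ball_residual \<sigma> z) \<le> norm (z - w)"
  using assms norm_triangle_ineq2[of z w] norm_ge_zero[of "z - w"]
  by (simp add: norm_ball_residual pos_part_def)

lemma half_pos_part_square_remainder:
  fixes y z :: "'a::real_inner" and \<sigma> :: real
  defines "h \<equiv> \<lambda>y::'a. 1 / 2 * (pos_part (norm y - \<sigma>))\<^sup>2"
  assumes "0 \<le> \<sigma>"
  shows "\<bar>h z - h y - (z - y) \<bullet> ball_residual \<sigma> y\<bar> \<le> (norm (z - y))\<^sup>2 / 2"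
proof -
  define T where "T = (ball_residual \<sigma> :: 'a \<Rightarrow> 'a)"
  have h: "h u = (T u \<bullet> T u) / 2" for u
    using norm_ball_residual[OF assms(2), of u] by (simp add: h_def T_def dot_square_norm)
  \<comment> \<open>Expanded, this says that \<open>h z - h y\<close> is at least
    \<open>T y \<bullet> (T z - T y)\<close>: convexity of half the squared norm.\<close>
  have "0 \<le> (T z - T y) \<bullet> (T z - T y)"
    by simp
  then have lower: "0 \<le> h z - h y - T y \<bullet> (z - y)"
    using ball_residual_inner_projection_diff[OF assms(2), of y z]
    unfolding h T_def by (simp add: inner_diff_left inner_diff_right inner_commute)
  \<comment> \<open>Upper bound: compare \<open>z\<close> with the projection of \<open>y\<close>
    instead of its own; squaring leaves exactly the quadratic term in \<open>z - y\<close>.\<close>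
  have "norm (T z) \<le> norm (z - (y - T y))"
    unfolding T_def
    by (intro norm_ball_residual_le norm_minus_ball_residual_le assms(2))
  also have "z - (y - T y) = (z - y) + T y"
    by simp
  finally have "T z \<bullet> T z \<le> ((z - y) + T y) \<bullet> ((z - y) + T y)"
    by (simp add: norm_le)
  then have "h z - h y - T y \<bullet> (z - y) \<le> ((z - y) \<bullet> (z - y)) / 2"
    unfolding h by (simp add: inner_left_distrib inner_right_distrib inner_commute)
  then show ?thesis
    using lower by (simp add: T_def inner_commute dot_square_norm)
qed

lemma has_derivative_quadratic_remainder:
  fixes f :: "'a::real_normed_vector \<Rightarrow> 'b::real_normed_vector"
  assumes "bounded_linear D"
    and bound: "\<And>z. norm (f z - f y - D (z - y)) \<le> C * (norm (z - y))\<^sup>2"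
  shows "(f has_derivative D) (at y)"
  unfolding has_derivative_iff_norm
proof (intro conjI assms(1))
  have "((\<lambda>z. C * norm (z - y)) \<longlongrightarrow> C * norm (y - y)) (at y)"
    by (intro tendsto_intros)
  then have lim: "((\<lambda>z. C * norm (z - y)) \<longlongrightarrow> 0) (at y)"
    by simp
  show "((\<lambda>z. norm (f z - f y - D (z - y)) / norm (z - y)) \<longlongrightarrow> 0) (at y)"
  proof (rule tendsto_sandwich[OF _ _ tendsto_const lim])
    show "\<forall>\<^sub>F z in at y. norm (f z - f y - D (z - y)) / norm (z - y) \<le> C * norm (z - y)"
      using bound by (auto simp: eventually_at_filter field_simps power2_eq_square)
  qed simp
qed

lemma has_derivative_half_pos_part_square:
  fixes y :: "'a::real_inner"
  assumes "0 \<le> \<sigma>"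
  shows "((\<lambda>y. 1 / 2 * (pos_part (norm y - \<sigma>))\<^sup>2) has_derivative
    (\<lambda>h. h \<bullet> ball_residual \<sigma> y)) (at y)"
  using half_pos_part_square_remainder[OF assms, of _ y]
  by (intro has_derivative_quadratic_remainder[where C = "1 / 2"] bounded_linear_inner_left) simp

lemma gradient_eqI: "GDERIV f x :> g \<Longrightarrow> gradient f x = g"
  unfolding gradient_def gderiv_def
  by (rule the_equality) (auto dest: has_derivative_unique simp: fun_eq_iff vector_eq_ldot)

section \<open>The spectral norm as operator norm\<close>

lemma inner_matrix_vector_mult_transpose:
  fixes A :: "real^'n^'m"
  shows "(A *v x) \<bullet> y = x \<bullet> (transpose A *v y)"
  by (metis dot_lmul_matrix inner_commute transpose_matrix_vector)

lemma inner_gram_matrix: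
  fixes A :: "real^'n^'m"
  shows "((transpose A ** A) *v x) \<bullet> y = (A *v x) \<bullet> (A *v y)"
  by (metis inner_commute inner_matrix_vector_mult_transpose matrix_vector_mul_assoc)

text \<open>Test \<open>u\<close>, the image of \<open>y\<close>, against itself, move the transpose
  across the inner product, and cancel one factor \<open>norm u\<close>.\<close>

lemma norm_transpose_mult_le:
  fixes A :: "real^'n^'m"
  assumes "\<And>x. norm (A *v x) \<le> L * norm x"
  shows "norm (transpose A *v y) \<le> L * norm y"
proof -
  define u where "u = transpose A *v y"
  have "norm u * norm u = (A *v u) \<bullet> y"
    unfolding inner_matrix_vector_mult_transpose u_def[symmetric]
    by (simp add: dot_square_norm power2_eq_square)
  also have "\<dots> \<le> norm (A *v u) * norm y"
    by (rule norm_cauchy_schwarz)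
  also have "\<dots> \<le> norm u * (L * norm y)"
    using mult_right_mono[OF assms norm_ge_zero] by (simp add: ac_simps)
  finally have "norm u \<le> L * norm y" if "u \<noteq> 0"
    using that by simp
  \<comment> \<open>Any unit vector shows that \<open>L\<close> is nonnegative, which settles the
    case \<open>u = 0\<close>.\<close>
  moreover have "0 \<le> L * norm y"
    using order_trans[OF norm_ge_zero assms[of "axis undefined 1"]] by (simp add: norm_axis_1)
  ultimately show ?thesis
    unfolding u_def[symmetric] by (cases "u = 0") auto
qed

text \<open>Eigenvectors of the symmetric matrix \<open>A\<^sup>T A\<close> for different eigenvalues are orthogonal.\<close>

lemma finite_singular_values:
  fixes A :: "real^'n^'m"
  shows "finite (singular_values A)"
proof -
  have "\<forall>s\<in>singular_values A. \<exists>v. 0 \<le> s \<and> v \<noteq> 0 \<and> (transpose A ** A) *v v = s\<^sup>2 *\<^sub>R v"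
    unfolding singular_values_def by blast
  then obtain v where v: "\<And>s. s \<in> singular_values A \<Longrightarrow>
      0 \<le> s \<and> v s \<noteq> 0 \<and> (transpose A ** A) *v v s = s\<^sup>2 *\<^sub>R v s"
    by metis
  have orth: "v s \<bullet> v t = 0"
    if "s \<in> singular_values A" "t \<in> singular_values A" "s \<noteq> t" for s t
  proof -
    have "s\<^sup>2 * (v s \<bullet> v t) = t\<^sup>2 * (v s \<bullet> v t)"
      using inner_gram_matrix[of A "v s" "v t"] inner_gram_matrix[of A "v t" "v s"]
        v[OF that(1)] v[OF that(2)] by (simp add: inner_commute)
    moreover have "s\<^sup>2 \<noteq> t\<^sup>2"
      using v that by simp
    ultimately show ?thesis
      by simp
  qed
  \<comment> \<open>A vector shared by two singular values would be orthogonal to itself, hence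
    zero.\<close>
  have "inj_on v (singular_values A)"
    by (rule inj_onI) (metis orth v inner_eq_zero_iff)
  moreover have "finite (v ` singular_values A)"
    using orth by (intro pairwise_orthogonal_imp_finite) (auto simp: pairwise_def orthogonal_def)
  ultimately show ?thesis
    using finite_imageD by blast
qed

text \<open>If \<open>v\<close> is a unit vector maximising \<open>norm (A *v v)\<close>, with maximum \<open>L\<close>, then
  \<open>norm (A\<^sup>T A v - L\<^sup>2 v)\<^sup>2 = norm (A\<^sup>T A v)\<^sup>2 - L\<^sup>4 \<le> 0\<close>.\<close>

lemma singular_value_norm_bound_exists:
  fixes A :: "real^'n^'m"
  obtains L where "L \<in> singular_values A" "\<And>x. norm (A *v x) \<le> L * norm x"
proof -
  have "\<exists>v\<in>sphere 0 1. \<forall>w\<in>sphere 0 1. norm (A *v w) \<le> norm (A *v v)"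
    by (intro continuous_attains_sup compact_sphere continuous_intros
        linear_continuous_on matrix_vector_mul_bounded_linear) simp
  then obtain v where v: "norm v = 1" and max: "\<And>w. norm w = 1 \<Longrightarrow> norm (A *v w) \<le> norm (A *v v)"
    by auto
  define L where "L = norm (A *v v)"
  have bound: "norm (A *v x) \<le> L * norm x" for x
  proof (cases "x = 0")
    case False
    then show ?thesis
      using max[of "inverse (norm x) *\<^sub>R x"]
      by (simp add: L_def matrix_vector_mult_scaleR field_simps)
  qed simp
  define u where "u = (transpose A ** A) *v v"
  \<comment> \<open>The bound for \<open>A\<close> passes to its transpose, applied here to
    \<open>A *v v\<close>, whose norm is \<open>L\<close>.\<close>
  have "norm u \<le> L * L"
    using norm_transpose_mult_le[OF bound, of "A *v v"]
    by (simp add: u_def L_def matrix_vector_mul_assoc)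
  then have "u \<bullet> u \<le> L\<^sup>2 * L\<^sup>2"
    using mult_mono[of "norm u" "L * L" "norm u" "L * L"]
    by (simp add: dot_square_norm power2_eq_square)
  moreover have "u \<bullet> v = L\<^sup>2"
    by (simp add: u_def inner_gram_matrix L_def dot_square_norm)
  moreover have "v \<bullet> v = 1"
    using v by (simp add: dot_square_norm)
  ultimately have "(u - L\<^sup>2 *\<^sub>R v) \<bullet> (u - L\<^sup>2 *\<^sub>R v) \<le> 0"
    by (simp add: inner_diff_left inner_diff_right inner_commute)
  then have "u = L\<^sup>2 *\<^sub>R v"
    by (metis eq_iff_diff_eq_0 inner_eq_zero_iff inner_ge_zero order_antisym)
  moreover have "v \<noteq> 0" "0 \<le> L"
    using v by (auto simp: L_def)
  ultimately have "L \<in> singular_values A"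
    unfolding singular_values_def u_def by blast
  then show thesis
    using that bound by blast
qed

text \<open>The bounding constant is itself a singular value, and \<open>Max\<close> over a finite
  set dominates it.\<close>

lemma norm_matrix_vector_mult_le_spectral_norm:
  fixes A :: "real^'n^'m"
  shows "norm (A *v x) \<le> spectral_norm A * norm x"
proof -
  obtain L where L: "L \<in> singular_values A" "norm (A *v x) \<le> L * norm x"
    using singular_value_norm_bound_exists by blast
  then have "L \<le> spectral_norm A"
    unfolding spectral_norm_def by (intro Max_ge finite_singular_values)
  then show ?thesis
    using L(2) by (meson mult_right_mono norm_ge_zero order_trans)
qed

section \<open>The gradient of the composition\<close>

lemma GDERIV_Phi:
  fixes A :: "real^'n^'m"
  assumes "0 \<le> \<sigma>"
  shows "GDERIV (Phi A b \<sigma>) x :> transpose A *v ball_residual \<sigma> (A *v x - b)"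
proof -
  have affine: "((\<lambda>x. A *v x - b) has_derivative (\<lambda>h. A *v h)) (at x)"
    by (auto intro!: derivative_eq_intros bounded_linear_imp_has_derivative
        matrix_vector_mul_bounded_linear)
  from has_derivative_compose[OF affine has_derivative_half_pos_part_square[OF assms]]
  show ?thesis
    by (simp add: gderiv_def Phi_def[abs_def] inner_matrix_vector_mult_transpose)
qed

theorem proposition5p6:
  fixes A :: "real^'n^'m" and b :: "real^'m" and \<sigma> :: real
  assumes "0 \<le> \<sigma>"
  shows "(\<forall>x. Phi A b \<sigma> differentiable (at x)) \<and>
    (\<exists>L. L-lipschitz_on UNIV (gradient (Phi A b \<sigma>))) \<and>
    (\<forall>x. gradient (Phi A b \<sigma>) x =
      (if norm (A *v x - b) \<le> \<sigma> then 0
       else (1 - \<sigma> / norm (A *v x - b)) *\<^sub>R (transpose A *v (A *v x - b)))) \<and>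
    ((spectral_norm A)\<^sup>2)-lipschitz_on UNIV (gradient (Phi A b \<sigma>))"
proof -
  let ?S = "spectral_norm A"
  let ?T = "\<lambda>x. ball_residual \<sigma> (A *v x - b)"
  note grad = gradient_eqI[OF GDERIV_Phi[OF assms]]
  have "Phi A b \<sigma> differentiable (at x)" for x
    using GDERIV_Phi[OF assms, of A b x] unfolding gderiv_def differentiable_def by blast
  moreover have "gradient (Phi A b \<sigma>) x =
      (if norm (A *v x - b) \<le> \<sigma> then 0
       else (1 - \<sigma> / norm (A *v x - b)) *\<^sub>R (transpose A *v (A *v x - b)))" for x
    by (simp add: grad ball_residual_def matrix_vector_mult_scaleR del: transpose_matrix_vector)
  moreover have "(?S\<^sup>2)-lipschitz_on UNIV (gradient (Phi A b \<sigma>))"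
  proof (rule lipschitz_onI)
    fix x y
    have S_nonneg: "0 \<le> ?S"
      using order_trans[OF norm_ge_zero
          norm_matrix_vector_mult_le_spectral_norm[of A "axis undefined 1"]]
      by (simp add: norm_axis_1)
    have "dist (gradient (Phi A b \<sigma>) x) (gradient (Phi A b \<sigma>) y)
        = norm (transpose A *v (?T x - ?T y))"
      by (simp add: grad dist_norm matrix_vector_mult_diff_distrib)
    also have "\<dots> \<le> ?S * norm (?T x - ?T y)"
      by (rule norm_transpose_mult_le[OF norm_matrix_vector_mult_le_spectral_norm])
    \<comment> \<open>Nonexpansiveness of the residual; \<open>b\<close> cancels in the
      difference.\<close>
    also have "\<dots> \<le> ?S * norm (A *v (x - y))"
      using norm_ball_residual_diff_le[OF assms, of "A *v x - b" "A *v y - b"] S_nonneg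
      by (simp add: matrix_vector_mult_diff_distrib mult_left_mono)
    also have "\<dots> \<le> ?S * (?S * norm (x - y))"
      by (intro mult_left_mono norm_matrix_vector_mult_le_spectral_norm S_nonneg)
    finally show "dist (gradient (Phi A b \<sigma>) x) (gradient (Phi A b \<sigma>) y) \<le> ?S\<^sup>2 * dist x y"
      by (simp add: dist_norm power2_eq_square mult.assoc)
  qed simp
  ultimately show ?thesis
    by blast
qed

end
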